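(* Let $\mathcal{S}=\mathbb{N}$, let $\mathcal{F}$ be the family of all infinite subsets of $\mathbb{N}$, and let $\mathcal{A}$, $\mathcal{A}_1$, $\{p_\alpha\}_\alpha$, $N$, $\Phi_{n,\ell}$, $b_{n,\ell}$, $b_{n,\ell,\alpha}^{-1}$, $T_{n,\ell}$ ($n\in\mathbb{N}$, $\ell\in\{1,\dots,N\}$) be as in the context and satisfy all the assumptions listed there. Suppose that there exist dense subsets $\mathcal{A}_0,\mathcal{B}_1,\dots,\mathcal{B}_N$ of $\mathcal{A}$ and a strictly increasing sequence $\{n_k\}_k\subseteq\mathbb{N}$ such that for all $s,\ell\in\{1,\dots,N\}$, every fixed $\alpha$ and all $x\in\mathcal{A}_0$, $y_s\in\mathcal{B}_s$, $$\lim_{k\to\infty}\|b_{n_k,s,\alpha}^{-1}\,y_s\|\;\|\Phi_{n_k,\ell}^{-1}(b_{n_k,\ell})\,x\|=0,$$ and, in addition, for all distinct $s,\ell\in\{1,\dots,N\}$ (every fixed $\alpha$ and all $y_s\in\mathcal{B}_s$) $$\lim_{k\to\infty}\|\Phi_{n_k,\ell}^{-1}(b_{n_k,\ell})\,\Phi_{n_k,s}^{-1}(b_{n_k,s,\alpha}^{-1}\,y_s)\|=0 .$$ Then the families $\{T_{n,1}\}_{n\in\mathbb{N}},\dots,\{T_{n,N}\}_{n\in\mathbb{N}}$ are $d\mathcal{F}$-semi-transitive on $\mathcal{A}$.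
   Context: Setting and standing assumptions (with index set $\mathcal{S}=\mathbb{N}$). - $\mathcal{A}$ is a non-unital normed algebra with norm $\|\cdot\|$, which is a left ideal in a unital normed algebra $\mathcal{A}_1$ with norm $\|\cdot\|_1$. The norm of $\mathcal{A}$ is not assumed to extend to $\mathcal{A}_1$. It is assumed that $\|ba\|\le\|b\|_1\|a\|$ for all $a\in\mathcal{A}$, $b\in\mathcal{A}_1$. - $\{p_\alpha\}_\alpha$ is a set of elements of $\mathcal{A}$ such that for every open subset $O$ of $\mathcal{A}$ and every $x\in O$ there is some $p_{\alpha_0}\in\{p_\alpha\}_\alpha$ with $p_{\alpha_0}^3x\in O$. - $N\in\mathbb{N}$. For $t\in\mathcal{S}$ and $\ell\in\{1,\dots,N\}$, $\Phi_{t,\ell}$ is an isometric algebra isomorphism of $\mathcal{A}_1$ onto itself with $\Phi_{t,\ell}(\mathcal{A})=\mathcal{A}$ and such that the restriction of $\Phi_{t,\ell}$ to $\mathcal{A}$ is an isometry for $\|\cdot\|$. - Disjoint aperiodicity with respect to $\{p_\alpha\}_\alpha$: for each $p_\alpha$ and every $H\in\mathcal{F}$ there is some $F\in\mathcal{F}$ with $F\subseteq H$ such that for all $t\in F$: $p_\alpha\Phi_{t,\ell}(p_\alpha)=0$ and $p_\alpha\Phi_{t,\ell}^{-1}(p_\alpha)=0$ for all $\ell\in\{1,\dots,N\}$, and $p_\alpha\Phi_{t,\ell}(\Phi_{t,r}^{-1}(p_\alpha))=0$ for all $r,\ell\in\{1,\dots,N\}$ with $r\ne\ell$. - For each $\alpha$,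 all $t\in\mathcal{S}$, $r,\ell\in\{1,\dots,N\}$ and $a\in\mathcal{A}$: $\|ap_\alpha\|\le\|a\|$, $\|a\Phi_{t,\ell}(p_\alpha)\|\le\|a\|$, $\|a\Phi_{t,\ell}^{-1}(p_\alpha)\|\le\|a\|$, $\|a\Phi_{t,\ell}(\Phi_{t,r}^{-1}(p_\alpha))\|\le\|a\|$. - For $t\in\mathcal{S}$, $\ell\in\{1,\dots,N\}$, $b_{t,\ell}\in\mathcal{A}_1$, and $T_{t,\ell}:\mathcal{A}\to\mathcal{A}$ is the bounded linear operator $T_{t,\ell}(a)=b_{t,\ell}\,\Phi_{t,\ell}(a)$. - For each $\alpha$, $t$, $\ell$ there is an element of $\mathcal{A}_1$, denoted $b_{t,\ell,\alpha}^{-1}$ and called an $\alpha$-inverse of $b_{t,\ell}$ (fixed once and for all), such that $b_{t,\ell}b_{t,\ell,\alpha}^{-1}ap_\alpha=b_{t,\ell,\alpha}^{-1}b_{t,\ell}ap_\alpha=ap_\alpha$ for all $a\in\mathcal{A}$. - For each $t\in\mathcal{S}$, $\ell\in\{1,\dots,N\}$ and $a\in\mathcal{A}$: $b_{t,\ell}a=0$ if and only if $a=0$. Definition. Families $\{T_{t,1}\}_{t\in\mathcal{S}},\dots,\{T_{t,N}\}_{t\in\mathcal{S}}$ of bounded linear operators on a normed space $X$ are called disjoint $\mathcal{F}$-semi-transitive ($d\mathcal{F}$-semi-transitive) if for all non-empty open subsets $\mathcal{O},V_1,\dots,V_N$ of $X$ there is some $F\in\mathcal{F}$ such that for every $t\in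 F$ there is a real $\lambda_t>0$ with $$\mathcal{O}\cap\lambda_tT_{t,1}^{-1}(V_1)\cap\dots\cap\lambda_tT_{t,N}^{-1}(V_N)\neq\varnothing,$$ where $T_{t,\ell}^{-1}(V_\ell)$ denotes the preimage. *)

theory Defs
  imports "HOL-Analysis.Analysis"
begin

text \<open>
  The unital algebra is a type of sort \<open>{real_normed_algebra, ring_1}\<close>, its norm being the
  type-class norm; \<open>norm 1 = 1\<close> is not required. The smaller algebra is a subset \<open>A\<close> of it with
  a norm \<open>nrm\<close> of its own, of which only the values on \<open>A\<close> matter. Scalars are real: a complex
  normed algebra is a real one by restriction of scalars, and complex subspaces and
  complex-linear maps are in particular real ones.
\<close>

definition norm_on :: "'a::real_vector set \<Rightarrow> ('a \<Rightarrow> real) \<Rightarrow> bool" where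
  "norm_on A nrm \<longleftrightarrow> subspace A \<and>
     (\<forall>x\<in>A. 0 \<le> nrm x) \<and>
     (\<forall>x\<in>A. nrm x = 0 \<longleftrightarrow> x = 0) \<and>
     (\<forall>x\<in>A. \<forall>y\<in>A. nrm (x + y) \<le> nrm x + nrm y) \<and>
     (\<forall>c. \<forall>x\<in>A. nrm (c *\<^sub>R x) = \<bar>c\<bar> * nrm x)"

definition normed_algebra_on :: "'a::real_algebra set \<Rightarrow> ('a \<Rightarrow> real) \<Rightarrow> bool" where
  "normed_algebra_on A nrm \<longleftrightarrow> norm_on A nrm \<and>
     (\<forall>x\<in>A. \<forall>y\<in>A. x * y \<in> A \<and> nrm (x * y) \<le> nrm x * nrm y)"

definition non_unital :: "'a::times set \<Rightarrow> bool" where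
  "non_unital A \<longleftrightarrow> \<not> (\<exists>e\<in>A. \<forall>a\<in>A. e * a = a \<and> a * e = a)"

definition left_ideal :: "'a::real_algebra set \<Rightarrow> bool" where
  "left_ideal A \<longleftrightarrow> subspace A \<and> (\<forall>b. \<forall>a\<in>A. b * a \<in> A)"

text \<open>
  The value \<open>0\<close> off \<open>A\<close> is there because the locale \<open>Metric_space\<close> wants the distance to be
  nonnegative and symmetric on the whole type.
\<close>

definition norm_dist :: "'a::real_vector set \<Rightarrow> ('a \<Rightarrow> real) \<Rightarrow> 'a \<Rightarrow> 'a \<Rightarrow> real" where
  "norm_dist A nrm x y = (if x \<in> A \<and> y \<in> A then nrm (x - y) else 0)"

definition norm_topology :: "'a::real_vector set \<Rightarrow> ('a \<Rightarrow> real) \<Rightarrow> 'a topology" where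
  "norm_topology A nrm = Metric_space.mtopology A (norm_dist A nrm)"

lemma Metric_space_norm_dist:
  assumes "norm_on A nrm"
  shows "Metric_space A (norm_dist A nrm)"
proof -
  from assms have "subspace A"
    and nonneg: "\<forall>x\<in>A. 0 \<le> nrm x"
    and zero: "\<forall>x\<in>A. nrm x = 0 \<longleftrightarrow> x = 0"
    and add: "\<forall>x\<in>A. \<forall>y\<in>A. nrm (x + y) \<le> nrm x + nrm y"
    and scale: "\<forall>c. \<forall>x\<in>A. nrm (c *\<^sub>R x) = \<bar>c\<bar> * nrm x"
    unfolding norm_on_def by - (elim conjE, assumption)+
  note diff = subspace_diff[OF \<open>subspace A\<close>]
  have sym: "nrm (x - y) = nrm (y - x)" if "x \<in> A" "y \<in> A" for x y
  proof -
    have "x - y = (-1) *\<^sub>R (y - x)"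
      by simp
    then have "nrm (x - y) = \<bar>-1\<bar> * nrm (y - x)"
      using scale[rule_format, OF diff[OF that(2,1)], of "-1"] by (simp only:)
    then show ?thesis
      by linarith
  qed
  show ?thesis
  proof
    show "0 \<le> norm_dist A nrm x y" for x y
      unfolding norm_dist_def using nonneg diff by simp
    show "norm_dist A nrm x y = norm_dist A nrm y x" for x y
      using sym by (auto simp only: norm_dist_def split: if_split)
    show "norm_dist A nrm x y = 0 \<longleftrightarrow> x = y" if "x \<in> A" "y \<in> A" for x y
      using zero[rule_format, OF diff[OF that]]
      by (simp only: norm_dist_def that if_True simp_thms right_minus_eq)
    show "norm_dist A nrm x z \<le> norm_dist A nrm x y + norm_dist A nrm y z"
      if "x \<in> A" "y \<in> A" "z \<in> A" for x y z
    proof -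
      have "nrm (x - z) \<le> nrm (x - y) + nrm (y - z)"
        using add[rule_format, OF diff[OF that(1,2)] diff[OF that(2,3)]]
        by (simp only: diff_add_cancel add_diff_eq)
      then show ?thesis
        by (simp only: norm_dist_def that if_True simp_thms)
    qed
  qed
qed

definition bounded_linear_op_on ::
    "'a::real_vector set \<Rightarrow> ('a \<Rightarrow> real) \<Rightarrow> ('a \<Rightarrow> 'a) \<Rightarrow> bool" where
  "bounded_linear_op_on A nrm T \<longleftrightarrow>
     T ` A \<subseteq> A \<and>
     (\<forall>x\<in>A. \<forall>y\<in>A. T (x + y) = T x + T y) \<and>
     (\<forall>c. \<forall>x\<in>A. T (c *\<^sub>R x) = c *\<^sub>R T x) \<and>
     (\<exists>K. \<forall>x\<in>A. nrm (T x) \<le> K * nrm x)"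

definition isometric_algebra_iso :: "('a::real_normed_algebra \<Rightarrow> 'a) \<Rightarrow> bool" where
  "isometric_algebra_iso \<phi> \<longleftrightarrow> linear \<phi> \<and> bij \<phi> \<and>
     (\<forall>x y. \<phi> (x * y) = \<phi> x * \<phi> y) \<and> (\<forall>x. norm (\<phi> x) = norm x)"

definition disjoint_aperiodic ::
    "'s set set \<Rightarrow> nat \<Rightarrow> ('s \<Rightarrow> nat \<Rightarrow> 'a \<Rightarrow> 'a) \<Rightarrow> ('i \<Rightarrow> 'a::ring) \<Rightarrow> bool" where
  "disjoint_aperiodic \<F> N \<Phi> p \<longleftrightarrow>
     (\<forall>\<alpha>. \<forall>H\<in>\<F>. \<exists>F\<in>\<F>. F \<subseteq> H \<and> (\<forall>t\<in>F.
        (\<forall>l\<in>{1..N}. p \<alpha> * \<Phi> t l (p \<alpha>) = 0 \<and> p \<alpha> * inv (\<Phi> t l) (p \<alpha>) = 0) \<and>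
        (\<forall>r\<in>{1..N}. \<forall>l\<in>{1..N}. r \<noteq> l \<longrightarrow> p \<alpha> * \<Phi> t l (inv (\<Phi> t r) (p \<alpha>)) = 0)))"

text \<open>
  The notion is defined for families of bounded linear operators on the normed space
  \<open>(A, nrm)\<close> only, hence the first conjunct. The image under multiplication by \<open>c\<close> is the
  dilated preimage: the set of all \<open>c *\<^sub>R x\<close> with \<open>x\<close> in \<open>A\<close> and \<open>T t l x\<close> in \<open>V l\<close>.
\<close>

definition dF_semi_transitive ::
    "'a::real_vector set \<Rightarrow> ('a \<Rightarrow> real) \<Rightarrow> 's set set \<Rightarrow> nat \<Rightarrow> ('s \<Rightarrow> nat \<Rightarrow> 'a \<Rightarrow> 'a) \<Rightarrow> bool"
  where
  "dF_semi_transitive A nrm \<F> N T \<longleftrightarrow>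
     (\<forall>t. \<forall>l\<in>{1..N}. bounded_linear_op_on A nrm (T t l)) \<and>
     (\<forall>U V. openin (norm_topology A nrm) U \<and> U \<noteq> {} \<and>
        (\<forall>l\<in>{1..N}. openin (norm_topology A nrm) (V l) \<and> V l \<noteq> {}) \<longrightarrow>
        (\<exists>F\<in>\<F>. \<forall>t\<in>F. \<exists>c>0.
           U \<inter> (\<Inter>l\<in>{1..N}. (*\<^sub>R) c ` {x \<in> A. T t l x \<in> V l}) \<noteq> {}))"

end

theory Submission
  imports Defs
begin

text \<open>
  Write \<open>T\<^sub>l = b\<^sub>l \<Phi>\<^sub>l\<close>, suppressing the time \<open>n k\<close>. The argument is that of the hypercyclicity
  criterion: a vector close to a given \<open>x\<close> whose image under every \<open>T\<^sub>l\<close> is nearly \<open>c\<close> times a given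
  \<open>w\<^sub>l\<close> is \<open>x + c \<Sum>\<^sub>s z\<^sub>s\<close>, where \<open>z\<^sub>l\<close> is an exact preimage of \<open>w\<^sub>l\<close> under \<open>T\<^sub>l\<close>. After division by \<open>c\<close> its
  image under \<open>T\<^sub>l\<close> is \<open>w\<^sub>l + T\<^sub>l x / c + \<Sum>\<^sub>s\<^sub>\<noteq>\<^sub>l T\<^sub>l z\<^sub>s\<close>. If all products of the size of a \<open>z\<^sub>s\<close> and the
  size of a \<open>T\<^sub>l x\<close> are small, a scalar \<open>c\<close> can be found that makes both \<open>c z\<^sub>s\<close> and \<open>T\<^sub>l x / c\<close>
  small; if moreover the mixed terms \<open>T\<^sub>l z\<^sub>s\<close> tend to \<open>0\<close>, this settles the matter
  (\<open>semi_transitive_from_exact_preimages\<close>).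

  The difficulty is to find targets \<open>w\<^sub>l\<close> that are dense and have exact preimages of controlled
  size. The \<open>\<alpha>\<close>-inverse of \<open>b\<^sub>l\<close> inverts \<open>b\<^sub>l\<close> only on products with a factor \<open>p \<alpha>\<close> inside, and the
  limits are known only on \<open>B l\<close>, whose elements need not be such products. The way out is to
  approximate the factor instead of the vector: if \<open>p \<alpha> ^ 3 * y\<close> lies in an open set, then so
  does \<open>w = g * (p \<alpha> ^ 2 * y)\<close> for every \<open>g\<close> in \<open>B l\<close> near \<open>p \<alpha>\<close> (\<open>dense_target\<close>). Such a \<open>w\<close> has
  the exact preimage \<open>\<Phi>\<^sub>l\<inverse> (b\<^sub>l\<inverse> g (p \<alpha> ^ 2 * y))\<close>, and since the right factor \<open>p \<alpha> ^ 2 * y\<close> does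
  not depend on time, submultiplicativity transfers the limits for \<open>g\<close> to this preimage. The
  index \<open>\<alpha>\<close> may differ from one \<open>l\<close> to the next, because every limit involves one \<open>\<alpha>\<close> only.
\<close>

section \<open>The topology of a norm on a subspace\<close>

lemma norm_onD:
  assumes "norm_on A nrm"
  shows "subspace A"
    and "x \<in> A \<Longrightarrow> 0 \<le> nrm x"
    and "x \<in> A \<Longrightarrow> y \<in> A \<Longrightarrow> nrm (x + y) \<le> nrm x + nrm y"
    and "x \<in> A \<Longrightarrow> nrm (c *\<^sub>R x) = \<bar>c\<bar> * nrm x"
proof -
  note c = assms[unfolded norm_on_def]
  show "subspace A"
    by (rule c[THEN conjunct1])
  show "x \<in> A \<Longrightarrow> 0 \<le> nrm x"
    by (rule c[THEN conjunct2, THEN conjunct1, THEN bspec])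
  show "x \<in> A \<Longrightarrow> y \<in> A \<Longrightarrow> nrm (x + y) \<le> nrm x + nrm y"
    by (rule c[THEN conjunct2, THEN conjunct2, THEN conjunct2, THEN conjunct1, THEN bspec, THEN bspec])
  show "x \<in> A \<Longrightarrow> nrm (c *\<^sub>R x) = \<bar>c\<bar> * nrm x"
    by (rule c[THEN conjunct2, THEN conjunct2, THEN conjunct2, THEN conjunct2, THEN spec, THEN bspec])
qed

lemma norm_on_zero:
  assumes "norm_on A nrm"
  shows "nrm 0 = 0"
  using norm_onD(4)[OF assms subspace_0[OF norm_onD(1)[OF assms]], of 0] by simp

lemma norm_on_sum_le:
  assumes nrm: "norm_on A nrm" and f: "\<And>i. i \<in> I \<Longrightarrow> f i \<in> A"
  shows "nrm (sum f I) \<le> (\<Sum>i\<in>I. nrm (f i))"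
  using f
proof (induction I rule: infinite_finite_induct)
  case (insert i I)
  have "sum f I \<in> A"
    using insert.prems by (intro subspace_sum norm_onD(1)[OF nrm]) auto
  then have "nrm (f i + sum f I) \<le> nrm (f i) + nrm (sum f I)"
    using insert.prems by (intro norm_onD(3)[OF nrm]) auto
  with insert show ?case
    by fastforce
qed (simp_all add: norm_on_zero[OF nrm])

lemma openin_norm_topology_iff:
  assumes nrm: "norm_on A nrm"
  shows "openin (norm_topology A nrm) U \<longleftrightarrow>
    U \<subseteq> A \<and> (\<forall>u\<in>U. \<exists>e>0. \<forall>z\<in>A. nrm (z - u) < e \<longrightarrow> z \<in> U)"
proof -
  interpret Metric_space A "norm_dist A nrm"
    by (rule Metric_space_norm_dist[OF nrm])
  have ball: "mball u e = {z \<in> A. nrm (z - u) < e}" if "u \<in> A" for u e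
  proof -
    have "z \<in> mball u e \<longleftrightarrow> z \<in> A \<and> nrm (z - u) < e" for z
      using that commute[of u z] by (auto simp: norm_dist_def)
    then show ?thesis
      by blast
  qed
  show ?thesis
    unfolding norm_topology_def openin_mtopology
    by (intro conj_cong refl) (force simp: ball)
qed

lemma norm_topology_dense:
  assumes nrm: "norm_on A nrm"
    and dense: "norm_topology A nrm closure_of D = A"
    and U: "openin (norm_topology A nrm) U" "U \<noteq> {}"
  obtains d where "d \<in> D" "d \<in> U"
proof -
  obtain u where u: "u \<in> U"
    using U by blast
  then have "u \<in> norm_topology A nrm closure_of D"
    using U openin_norm_topology_iff[OF nrm] dense by blast
  then show thesis
    using U u that by (auto simp: in_closure_of)
qed

section \<open>A criterion by exact preimages\<close>

text \<open>
  This is the only place where the freedom of choosing the scalar is used: the product of two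
  sizes being small does not make either of them small, but a scaling balances them.
\<close>

lemma balancing_scalar:
  fixes a c e :: real
  assumes "0 \<le> a" "0 \<le> c" "0 < e" "a * c < e * e"
  obtains r where "0 < r" "r * a < e" "c / r < e"
proof (cases "a = 0")
  case True
  have "0 < c / e + 1" "c < e * (c / e + 1)"
    using assms by (simp_all add: add_nonneg_pos distrib_left)
  then show thesis
    using that[of "c / e + 1"] True assms by (simp add: pos_divide_less_eq)
next
  case False
  then have "0 < a"
    using assms by simp
  then have "c / e < e / a"
    using assms by (simp add: field_simps)
  then obtain r where r: "c / e < r" "r < e / a"
    using dense by blast
  have "0 < r"
    using r(1) assms by (meson divide_nonneg_pos le_less_trans)
  with r show thesis
    using that[of r] assms \<open>0 < a\<close> by (simp add: field_simps)
qed

text \<open>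
  The witness at time \<open>n k\<close> is \<open>x + r *\<^sub>R (\<Sum>s. z k s)\<close> with \<open>r\<close> the balancing scalar of the total
  sizes of the \<open>z k s\<close> and of the \<open>T (n k) l x\<close>.
\<close>

lemma semi_transitive_from_exact_preimages:
  fixes T :: "nat \<Rightarrow> nat \<Rightarrow> 'a::real_vector \<Rightarrow> 'a"
  assumes nrm: "norm_on A nrm"
    and T: "\<And>t l. l \<in> {1..N} \<Longrightarrow> bounded_linear_op_on A nrm (T t l)"
    and n: "strict_mono n"
    and U: "openin (norm_topology A nrm) U" "x \<in> U"
    and V: "\<And>l. l \<in> {1..N} \<Longrightarrow> openin (norm_topology A nrm) (V l)"
      "\<And>l. l \<in> {1..N} \<Longrightarrow> w l \<in> V l"
    and z: "\<And>k s. s \<in> {1..N} \<Longrightarrow> z k s \<in> A"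
    and exact: "\<And>k l. l \<in> {1..N} \<Longrightarrow> T (n k) l (z k l) = w l"
    and product: "\<And>s l. s \<in> {1..N} \<Longrightarrow> l \<in> {1..N} \<Longrightarrow>
          (\<lambda>k. nrm (z k s) * nrm (T (n k) l x)) \<longlonglongrightarrow> 0"
    and mixed: "\<And>s l. s \<in> {1..N} \<Longrightarrow> l \<in> {1..N} \<Longrightarrow> s \<noteq> l \<Longrightarrow>
          (\<lambda>k. nrm (T (n k) l (z k s))) \<longlonglongrightarrow> 0"
  shows "\<exists>F. infinite F \<and> (\<forall>t\<in>F. \<exists>c>0.
           U \<inter> (\<Inter>l\<in>{1..N}. (*\<^sub>R) c ` {x \<in> A. T t l x \<in> V l}) \<noteq> {})"
proof -
  let ?L = "{1..N}"
  note sub = norm_onD(1)[OF nrm]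
  have T_in: "T t l a \<in> A" if "l \<in> ?L" "a \<in> A" for t l a
    using T[OF that(1)] that(2) unfolding bounded_linear_op_on_def by (simp add: image_subset_iff)
  have T_add: "T t l (a + a') = T t l a + T t l a'" if "l \<in> ?L" "a \<in> A" "a' \<in> A" for t l a a'
    using T[OF that(1)] that(2,3) unfolding bounded_linear_op_on_def by simp
  have T_scale: "T t l (c *\<^sub>R a) = c *\<^sub>R T t l a" if "l \<in> ?L" "a \<in> A" for t l a c
    using T[OF that(1)] that(2) unfolding bounded_linear_op_on_def by (simp add: image_subset_iff)
  have T_sum: "T t l (sum f I) = (\<Sum>i\<in>I. T t l (f i))"
    if l: "l \<in> ?L" and f: "\<And>i. i \<in> I \<Longrightarrow> f i \<in> A" for t l I and f :: "nat \<Rightarrow> 'a"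
    using f
  proof (induction I rule: infinite_finite_induct)
    case (insert i I)
    then have "sum f I \<in> A"
      by (intro subspace_sum sub) auto
    with insert show ?case
      using T_add[OF l] by simp
  qed (use T_scale[OF l subspace_0[OF sub], of t 0] in simp_all)
  have x: "x \<in> A"
    using U openin_norm_topology_iff[OF nrm] by blast
  obtain d where d: "0 < d" "\<And>v. v \<in> A \<Longrightarrow> nrm (v - x) < d \<Longrightarrow> v \<in> U"
    using U openin_norm_topology_iff[OF nrm] by metis
  have "\<forall>l\<in>?L. \<exists>e>0. \<forall>v\<in>A. nrm (v - w l) < e \<longrightarrow> v \<in> V l"
    using V openin_norm_topology_iff[OF nrm] by meson
  then obtain e where e: "\<And>l. l \<in> ?L \<Longrightarrow> 0 < e l"
      "\<And>l v. l \<in> ?L \<Longrightarrow> v \<in> A \<Longrightarrow> nrm (v - w l) < e l \<Longrightarrow> v \<in> V l"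
    by metis
  define \<epsilon> where "\<epsilon> = Min (insert d (e ` ?L)) / 2"
  have \<epsilon>: "0 < \<epsilon>" "2 * \<epsilon> \<le> d" "\<And>l. l \<in> ?L \<Longrightarrow> 2 * \<epsilon> \<le> e l"
  proof -
    have "Min (insert d (e ` ?L)) \<le> v" if "v \<in> insert d (e ` ?L)" for v
      using that by (intro Min_le) auto
    moreover have "0 < Min (insert d (e ` ?L))"
      using d(1) e(1) by (subst Min_gr_iff) auto
    ultimately show "0 < \<epsilon>" "2 * \<epsilon> \<le> d" "\<And>l. l \<in> ?L \<Longrightarrow> 2 * \<epsilon> \<le> e l"
      unfolding \<epsilon>_def by auto
  qed
  define Z where "Z k = (\<Sum>s\<in>?L. nrm (z k s))" for k
  define X where "X k = (\<Sum>l\<in>?L. nrm (T (n k) l x))" for k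
  define M where "M k l = (\<Sum>s\<in>?L - {l}. nrm (T (n k) l (z k s)))" for k l
  have "(\<lambda>k. Z k * X k) \<longlonglongrightarrow> 0"
    unfolding Z_def X_def sum_product by (intro tendsto_null_sum product)
  then have "\<forall>\<^sub>F k in sequentially. Z k * X k < \<epsilon> * \<epsilon>"
    using \<epsilon>(1) by (intro order_tendstoD) auto
  moreover have "\<forall>\<^sub>F k in sequentially. \<forall>l\<in>?L. M k l < \<epsilon>"
  proof (intro eventually_ball_finite ballI finite_atLeastAtMost)
    fix l assume "l \<in> ?L"
    then have "(\<lambda>k. M k l) \<longlonglongrightarrow> 0"
      unfolding M_def by (intro tendsto_null_sum mixed) auto
    then show "\<forall>\<^sub>F k in sequentially. M k l < \<epsilon>"
      using \<epsilon>(1) by (intro order_tendstoD)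
  qed
  ultimately have "\<forall>\<^sub>F k in sequentially. Z k * X k < \<epsilon> * \<epsilon> \<and> (\<forall>l\<in>?L. M k l < \<epsilon>)"
    by (rule eventually_conj)
  then obtain K where K: "\<And>k. k \<ge> K \<Longrightarrow> Z k * X k < \<epsilon> * \<epsilon>"
      "\<And>k l. k \<ge> K \<Longrightarrow> l \<in> ?L \<Longrightarrow> M k l < \<epsilon>"
    unfolding eventually_sequentially by blast
  have "\<exists>c>0. U \<inter> (\<Inter>l\<in>?L. (*\<^sub>R) c ` {a \<in> A. T (n k) l a \<in> V l}) \<noteq> {}" if k: "k \<ge> K" for k
  proof -
    have "0 \<le> Z k" "0 \<le> X k"
      unfolding Z_def X_def by (auto intro!: sum_nonneg norm_onD(2)[OF nrm] z T_in x)
    then obtain r where r: "0 < r" "r * Z k < \<epsilon>" "X k / r < \<epsilon>"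
      using balancing_scalar \<epsilon>(1) K(1)[OF k] by blast
    define S where "S = (\<Sum>s\<in>?L. z k s)"
    have S: "S \<in> A"
      unfolding S_def by (intro subspace_sum sub z)
    define a where "a = (1 / r) *\<^sub>R x + S"
    have a: "a \<in> A"
      unfolding a_def by (intro subspace_add subspace_scale sub x S)
    have ra: "r *\<^sub>R a = x + r *\<^sub>R S"
      using r(1) by (simp add: a_def scaleR_add_right)
    have "r *\<^sub>R a \<in> U"
    proof (rule d(2))
      show "r *\<^sub>R a \<in> A"
        by (intro subspace_scale sub a)
      have "nrm (r *\<^sub>R a - x) = r * nrm S"
        using norm_onD(4)[OF nrm S] r(1) by (simp add: ra)
      also have "\<dots> \<le> r * Z k"
        unfolding S_def Z_def using r(1) by (intro mult_left_mono norm_on_sum_le[OF nrm] z) auto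
      also have "\<dots> < d"
        using r(2) \<epsilon>(1,2) by linarith
      finally show "nrm (r *\<^sub>R a - x) < d" .
    qed
    moreover have "T (n k) l a \<in> V l" if l: "l \<in> ?L" for l
    proof (rule e(2)[OF l T_in[OF l a]])
      define R where "R = (\<Sum>s\<in>?L - {l}. T (n k) l (z k s))"
      have R: "R \<in> A"
        unfolding R_def by (intro subspace_sum sub T_in l z) auto
      have "T (n k) l S = (\<Sum>s\<in>?L. T (n k) l (z k s))"
        unfolding S_def by (rule T_sum[OF l z])
      also have "\<dots> = w l + R"
        unfolding R_def by (subst sum.remove[OF finite_atLeastAtMost l]) (simp only: exact[OF l])
      finally have "T (n k) l S = w l + R" .
      then have "T (n k) l a - w l = (1 / r) *\<^sub>R T (n k) l x + R"
        unfolding a_def using l x S by (simp add: T_add T_scale subspace_scale sub)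
      then have "nrm (T (n k) l a - w l) \<le> nrm ((1 / r) *\<^sub>R T (n k) l x) + nrm R"
        using norm_onD(3)[OF nrm subspace_scale[OF sub T_in[OF l x]] R] by simp
      also have "nrm ((1 / r) *\<^sub>R T (n k) l x) = nrm (T (n k) l x) / r"
        using norm_onD(4)[OF nrm T_in[OF l x]] r(1) by simp
      also have "\<dots> \<le> X k / r"
        unfolding X_def using r(1) l
        by (intro divide_right_mono member_le_sum norm_onD(2)[OF nrm] T_in x) auto
      also have "nrm R \<le> M k l"
        unfolding R_def M_def by (intro norm_on_sum_le[OF nrm] T_in l z) auto
      finally show "nrm (T (n k) l a - w l) < e l"
        using r(3) K(2)[OF k l] \<epsilon>(3)[OF l] by linarith
    qed
    ultimately have "r *\<^sub>R a \<in> U \<inter> (\<Inter>l\<in>?L. (*\<^sub>R) r ` {a \<in> A. T (n k) l a \<in> V l})"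
      using a by blast
    then show ?thesis
      using r(1) by blast
  qed
  moreover have "infinite (n ` {K..})"
    using strict_mono_imp_inj_on[OF n] by (simp add: finite_image_iff infinite_Ici inj_on_subset)
  ultimately show ?thesis
    by (intro exI[of _ "n ` {K..}"]) auto
qed

section \<open>Weighted isometric isomorphisms\<close>

lemma inv_isometric_algebra_iso:
  assumes "isometric_algebra_iso \<phi>"
  shows "\<phi> (inv \<phi> x) = x" "inv \<phi> (\<phi> x) = x" "inv \<phi> (x * y) = inv \<phi> x * inv \<phi> y"
proof -
  have bij: "bij \<phi>" and mult: "\<And>x y. \<phi> (x * y) = \<phi> x * \<phi> y"
    using assms unfolding isometric_algebra_iso_def by simp_all
  show right: "\<phi> (inv \<phi> x) = x" for x
    using bij by (simp add: bij_is_surj surj_f_inv_f)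
  show left: "inv \<phi> (\<phi> x) = x" for x
    using bij by (simp add: bij_is_inj)
  have "x * y = \<phi> (inv \<phi> x * inv \<phi> y)"
    by (simp add: mult right)
  then show "inv \<phi> (x * y) = inv \<phi> x * inv \<phi> y"
    by (simp only: left)
qed

lemma inv_iso_preserves:
  assumes iso: "isometric_algebra_iso \<phi>"
    and img: "\<phi> ` A = A" and isom: "\<And>a. a \<in> A \<Longrightarrow> nrm (\<phi> a) = nrm a" and a: "a \<in> A"
  shows "inv \<phi> a \<in> A" "nrm (inv \<phi> a) = nrm a"
proof -
  obtain a' where "a' \<in> A" "a = \<phi> a'"
    using a img by blast
  then show "inv \<phi> a \<in> A" "nrm (inv \<phi> a) = nrm a"
    using isom inv_isometric_algebra_iso(2)[OF iso] by simp_all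
qed

lemma weighted_iso_bounded_linear:
  fixes \<phi> :: "'a::real_normed_algebra \<Rightarrow> 'a"
  assumes ideal: "left_ideal A"
    and nrm_mult: "\<And>a c. a \<in> A \<Longrightarrow> nrm (c * a) \<le> norm c * nrm a"
    and iso: "isometric_algebra_iso \<phi>"
    and img: "\<phi> ` A = A" and isom: "\<And>a. a \<in> A \<Longrightarrow> nrm (\<phi> a) = nrm a"
  shows "bounded_linear_op_on A nrm (\<lambda>a. c * \<phi> a)"
proof -
  have lin: "linear \<phi>"
    using iso unfolding isometric_algebra_iso_def by simp
  have "nrm (c * \<phi> a) \<le> norm c * nrm a" if "a \<in> A" for a
    using nrm_mult[of "\<phi> a" c] isom[OF that] img that by auto
  moreover have "c * \<phi> a \<in> A" if "a \<in> A" for a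
    using ideal img that unfolding left_ideal_def by blast
  ultimately show ?thesis
    unfolding bounded_linear_op_on_def
    by (auto simp: linear_add[OF lin] linear_cmul[OF lin] distrib_left)
qed

text \<open>
  Transporting the weight back through \<open>\<phi>\<close> turns the value of a weighted isomorphism into a plain
  product of the same size. This is the form in which the limit hypotheses measure it.
\<close>

lemma weighted_iso_norm:
  assumes ideal: "left_ideal A"
    and iso: "isometric_algebra_iso \<phi>"
    and isom: "\<And>a. a \<in> A \<Longrightarrow> nrm (\<phi> a) = nrm a" and a: "a \<in> A"
  shows "nrm (c * \<phi> a) = nrm (inv \<phi> c * a)"
proof -
  have "\<phi> (inv \<phi> c * a) = c * \<phi> a"
    using iso inv_isometric_algebra_iso(1)[OF iso] unfolding isometric_algebra_iso_def by simp
  moreover have "inv \<phi> c * a \<in> A"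
    using ideal a unfolding left_ideal_def by blast
  ultimately show ?thesis
    using isom by metis
qed

text \<open>
  The dense set is made to approximate the factor \<open>q\<close> rather than the vector \<open>q ^ 3 * y\<close>: right
  multiplication by the fixed element \<open>q ^ 2 * y\<close> is continuous, and it leaves a factor \<open>q\<close> next to
  \<open>g\<close>, where the \<open>\<alpha>\<close>-inverse relation needs it.
\<close>

lemma dense_target:
  fixes A :: "'a::{real_algebra, ring_1} set"
  assumes alg: "normed_algebra_on A nrm"
    and V: "openin (norm_topology A nrm) V" "q ^ 3 * y \<in> V"
    and q: "q \<in> A" and y: "y \<in> A"
    and dense: "norm_topology A nrm closure_of D = A"
  obtains g where "g \<in> D" "g * (q ^ 2 * y) \<in> V"
proof -
  have nrm: "norm_on A nrm" and closed: "\<And>a c. a \<in> A \<Longrightarrow> c \<in> A \<Longrightarrow> a * c \<in> A"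
    and submult: "\<And>a c. a \<in> A \<Longrightarrow> c \<in> A \<Longrightarrow> nrm (a * c) \<le> nrm a * nrm c"
    using alg unfolding normed_algebra_on_def by blast+
  note diff = subspace_diff[OF norm_onD(1)[OF nrm]]
  define u where "u = q ^ 2 * y"
  have u: "u \<in> A"
    unfolding u_def power2_eq_square by (intro closed q y)
  have qu: "q ^ 3 * y = q * u"
    by (simp add: u_def power2_eq_square power3_eq_cube mult.assoc)
  have u_nonneg: "0 \<le> nrm u"
    by (rule norm_onD(2)[OF nrm u])
  define W where "W = {g \<in> A. g * u \<in> V}"
  have "openin (norm_topology A nrm) W"
    unfolding openin_norm_topology_iff[OF nrm]
  proof (intro conjI ballI)
    fix g assume g: "g \<in> W"
    then obtain e where e: "0 < e" "\<And>v. v \<in> A \<Longrightarrow> nrm (v - g * u) < e \<Longrightarrow> v \<in> V"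
      using V openin_norm_topology_iff[OF nrm] unfolding W_def by (metis mem_Collect_eq)
    show "\<exists>d>0. \<forall>h\<in>A. nrm (h - g) < d \<longrightarrow> h \<in> W"
    proof (intro exI[of _ "e / (nrm u + 1)"] conjI ballI impI)
      show "0 < e / (nrm u + 1)"
        using e(1) u_nonneg by simp
      fix h assume h: "h \<in> A" "nrm (h - g) < e / (nrm u + 1)"
      have hg: "h - g \<in> A"
        using g h(1) by (auto simp: W_def intro: diff)
      have "nrm (h * u - g * u) \<le> nrm (h - g) * nrm u"
        using submult[OF hg u] by (simp add: left_diff_distrib)
      also have "\<dots> \<le> nrm (h - g) * (nrm u + 1)"
        using norm_onD(2)[OF nrm hg] by (intro mult_left_mono) auto
      also have "\<dots> < e"
        using h(2) u_nonneg by (simp add: pos_less_divide_eq)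
      finally show "h \<in> W"
        using e(2) closed[OF h(1) u] h(1) by (auto simp: W_def)
    qed
  qed (auto simp: W_def)
  moreover have "W \<noteq> {}"
    using V(2) q by (auto simp: W_def qu)
  ultimately obtain g where "g \<in> D" "g \<in> W"
    using norm_topology_dense[OF nrm dense] by blast
  then show thesis
    using that by (auto simp: W_def u_def)
qed

section \<open>Semi-transitivity of weighted isomorphisms\<close>

theorem corollary3p2:
  fixes A :: "'a::{real_normed_algebra, ring_1} set"
    and nrm :: "'a \<Rightarrow> real"
    and p :: "'i \<Rightarrow> 'a"
    and N :: nat
    and \<Phi> :: "nat \<Rightarrow> nat \<Rightarrow> 'a \<Rightarrow> 'a"
    and b :: "nat \<Rightarrow> nat \<Rightarrow> 'a"
    and binv :: "nat \<Rightarrow> nat \<Rightarrow> 'i \<Rightarrow> 'a"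
    and A\<^sub>0 :: "'a set"
    and B :: "nat \<Rightarrow> 'a set"
    and n :: "nat \<Rightarrow> nat"
  assumes alg: "normed_algebra_on A nrm"
    and nonunital: "non_unital A"
    and ideal: "left_ideal A"
    and nrm_mult: "\<And>a c. a \<in> A \<Longrightarrow> nrm (c * a) \<le> norm c * nrm a"
    and p_in: "\<And>\<alpha>. p \<alpha> \<in> A"
    and p_approx: "\<And>U x. openin (norm_topology A nrm) U \<Longrightarrow> x \<in> U \<Longrightarrow> \<exists>\<alpha>. p \<alpha> ^ 3 * x \<in> U"
    and \<Phi>_iso: "\<And>t l. l \<in> {1..N} \<Longrightarrow> isometric_algebra_iso (\<Phi> t l)"
    and \<Phi>_A: "\<And>t l. l \<in> {1..N} \<Longrightarrow> \<Phi> t l ` A = A"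
    and \<Phi>_nrm: "\<And>t l a. l \<in> {1..N} \<Longrightarrow> a \<in> A \<Longrightarrow> nrm (\<Phi> t l a) = nrm a"
    and aperiodic: "disjoint_aperiodic {F :: nat set. infinite F} N \<Phi> p"
    and contr1: "\<And>\<alpha> a. a \<in> A \<Longrightarrow> nrm (a * p \<alpha>) \<le> nrm a"
    and contr2: "\<And>\<alpha> t l a. l \<in> {1..N} \<Longrightarrow> a \<in> A \<Longrightarrow> nrm (a * \<Phi> t l (p \<alpha>)) \<le> nrm a"
    and contr3: "\<And>\<alpha> t l a. l \<in> {1..N} \<Longrightarrow> a \<in> A \<Longrightarrow> nrm (a * inv (\<Phi> t l) (p \<alpha>)) \<le> nrm a"
    and contr4: "\<And>\<alpha> t r l a. r \<in> {1..N} \<Longrightarrow> l \<in> {1..N} \<Longrightarrow> a \<in> A \<Longrightarrow>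
          nrm (a * \<Phi> t l (inv (\<Phi> t r) (p \<alpha>))) \<le> nrm a"
    and \<alpha>_inverse: "\<And>t l \<alpha> a. l \<in> {1..N} \<Longrightarrow> a \<in> A \<Longrightarrow>
          b t l * binv t l \<alpha> * a * p \<alpha> = a * p \<alpha> \<and> binv t l \<alpha> * b t l * a * p \<alpha> = a * p \<alpha>"
    and b_inj: "\<And>t l a. l \<in> {1..N} \<Longrightarrow> a \<in> A \<Longrightarrow> b t l * a = 0 \<longleftrightarrow> a = 0"
    and A\<^sub>0_dense: "A\<^sub>0 \<subseteq> A" "norm_topology A nrm closure_of A\<^sub>0 = A"
    and B_dense: "\<And>s. s \<in> {1..N} \<Longrightarrow> B s \<subseteq> A"
          "\<And>s. s \<in> {1..N} \<Longrightarrow> norm_topology A nrm closure_of B s = A"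
    and n_mono: "strict_mono n"
    and lim1: "\<And>s l \<alpha> x y. s \<in> {1..N} \<Longrightarrow> l \<in> {1..N} \<Longrightarrow> x \<in> A\<^sub>0 \<Longrightarrow> y \<in> B s \<Longrightarrow>
          (\<lambda>k. nrm (binv (n k) s \<alpha> * y) * nrm (inv (\<Phi> (n k) l) (b (n k) l) * x)) \<longlonglongrightarrow> 0"
    and lim2: "\<And>s l \<alpha> y. s \<in> {1..N} \<Longrightarrow> l \<in> {1..N} \<Longrightarrow> s \<noteq> l \<Longrightarrow> y \<in> B s \<Longrightarrow>
          (\<lambda>k. nrm (inv (\<Phi> (n k) l) (b (n k) l) * inv (\<Phi> (n k) s) (binv (n k) s \<alpha> * y)))
            \<longlonglongrightarrow> 0"
  shows "dF_semi_transitive A nrm {F :: nat set. infinite F} N (\<lambda>t l a. b t l * \<Phi> t l a)"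
proof -
  let ?L = "{1..N}" and ?T = "\<lambda>t l a. b t l * \<Phi> t l a"
  have nrm: "norm_on A nrm" and submult: "\<And>a c. a \<in> A \<Longrightarrow> c \<in> A \<Longrightarrow> nrm (a * c) \<le> nrm a * nrm c"
    using alg unfolding normed_algebra_on_def by blast+
  have left: "c * a \<in> A" if "a \<in> A" for a c
    using ideal that unfolding left_ideal_def by blast
  have inv_in: "inv (\<Phi> t l) a \<in> A" and inv_nrm: "nrm (inv (\<Phi> t l) a) = nrm a"
    and T_nrm: "nrm (c * \<Phi> t l a) = nrm (inv (\<Phi> t l) c * a)"
    if l: "l \<in> ?L" and a: "a \<in> A" for t l a c
    using inv_iso_preserves[where \<phi> = "\<Phi> t l" and nrm = nrm, OF \<Phi>_iso[OF l] \<Phi>_A[OF l] _ a]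
      weighted_iso_norm[where \<phi> = "\<Phi> t l" and nrm = nrm, OF ideal \<Phi>_iso[OF l] _ a] \<Phi>_nrm[OF l]
    by simp_all
  have T: "bounded_linear_op_on A nrm (?T t l)" if "l \<in> ?L" for t l
    by (rule weighted_iso_bounded_linear[where \<phi> = "\<Phi> t l" and nrm = nrm,
          OF ideal _ \<Phi>_iso[OF that] \<Phi>_A[OF that]])
      (erule nrm_mult, erule \<Phi>_nrm[OF that])
  have semi: "\<exists>F. infinite F \<and> (\<forall>t\<in>F. \<exists>c>0. U \<inter> (\<Inter>l\<in>?L. (*\<^sub>R) c ` {x \<in> A. ?T t l x \<in> V l}) \<noteq> {})"
    if U: "openin (norm_topology A nrm) U" "U \<noteq> {}"
      and V: "\<And>l. l \<in> ?L \<Longrightarrow> openin (norm_topology A nrm) (V l)" "\<And>l. l \<in> ?L \<Longrightarrow> V l \<noteq> {}" for U V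
  proof -
    obtain x where x: "x \<in> A\<^sub>0" "x \<in> U"
      using norm_topology_dense[OF nrm A\<^sub>0_dense(2) U] by blast
    have "\<exists>\<alpha> y g. y \<in> A \<and> g \<in> B l \<and> g * (p \<alpha> ^ 2 * y) \<in> V l" if l: "l \<in> ?L" for l
    proof -
      obtain y where y: "y \<in> V l"
        using V(2)[OF l] by blast
      then have yA: "y \<in> A"
        using V(1)[OF l] openin_norm_topology_iff[OF nrm] by blast
      obtain \<alpha> where "p \<alpha> ^ 3 * y \<in> V l"
        using p_approx[OF V(1)[OF l] y] by blast
      then obtain g where "g \<in> B l" "g * (p \<alpha> ^ 2 * y) \<in> V l"
        using dense_target[OF alg V(1)[OF l] _ p_in yA B_dense(2)[OF l]] by blast
      with yA show ?thesis
        by blast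
    qed
    then obtain \<alpha> y g where y: "\<And>l. l \<in> ?L \<Longrightarrow> y l \<in> A" and g: "\<And>l. l \<in> ?L \<Longrightarrow> g l \<in> B l"
      and w: "\<And>l. l \<in> ?L \<Longrightarrow> g l * (p (\<alpha> l) ^ 2 * y l) \<in> V l"
      by metis
    have gA: "g l \<in> A" if "l \<in> ?L" for l
      using g B_dense(1) that by blast
    define u where "u l = p (\<alpha> l) ^ 2 * y l" for l
    have u: "u l \<in> A" if "l \<in> ?L" for l
      unfolding u_def by (intro left y that)
    define h where "h k s = binv (n k) s (\<alpha> s) * g s" for k s
    have h: "h k s \<in> A" if "s \<in> ?L" for k s
      unfolding h_def by (intro left gA that)
    define z where "z k s = inv (\<Phi> (n k) s) (h k s * u s)" for k s
    have hu: "h k s * u s \<in> A" if "s \<in> ?L" for k s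
      by (intro left u that)
    have z: "z k s \<in> A" if "s \<in> ?L" for k s
      unfolding z_def by (intro inv_in hu that)
    have exact: "?T (n k) l (z k l) = g l * u l" if l: "l \<in> ?L" for k l
    proof -
      have "?T (n k) l (z k l) = b (n k) l * binv (n k) l (\<alpha> l) * g l * p (\<alpha> l) * (p (\<alpha> l) * y l)"
        by (simp add: z_def inv_isometric_algebra_iso(1)[OF \<Phi>_iso[OF l]] h_def u_def
            power2_eq_square mult.assoc)
      \<comment> \<open>The square is split: one factor serves the relation for the inverse, the other goes with \<open>y l\<close>.\<close>
      also have "\<dots> = g l * p (\<alpha> l) * (p (\<alpha> l) * y l)"
        using \<alpha>_inverse[OF l gA[OF l]] by simp
      also have "\<dots> = g l * u l"
        by (simp add: u_def power2_eq_square mult.assoc)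
      finally show ?thesis .
    qed
    have product: "(\<lambda>k. nrm (z k s) * nrm (?T (n k) l x)) \<longlonglongrightarrow> 0" if s: "s \<in> ?L" and l: "l \<in> ?L" for s l
    proof (rule tendsto_0_le[where K = "nrm (u s)"])
      show "(\<lambda>k. nrm (h k s) * nrm (inv (\<Phi> (n k) l) (b (n k) l) * x)) \<longlonglongrightarrow> 0"
        unfolding h_def by (rule lim1[OF s l x(1) g[OF s]])
      show "\<forall>\<^sub>F k in sequentially. norm (nrm (z k s) * nrm (?T (n k) l x)) \<le>
          norm (nrm (h k s) * nrm (inv (\<Phi> (n k) l) (b (n k) l) * x)) * nrm (u s)"
      proof (rule always_eventually, rule allI)
        fix k
        have xA: "x \<in> A"
          using x(1) A\<^sub>0_dense(1) by blast
        let ?X = "nrm (inv (\<Phi> (n k) l) (b (n k) l) * x)"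
        have nonneg: "0 \<le> ?X" "0 \<le> nrm (z k s)" "0 \<le> nrm (h k s)"
          by (intro norm_onD(2)[OF nrm] left xA z h s)+
        have "nrm (z k s) \<le> nrm (h k s) * nrm (u s)"
          unfolding z_def inv_nrm[OF s hu[OF s]] by (rule submult[OF h[OF s] u[OF s]])
        then have "nrm (z k s) * ?X \<le> nrm (h k s) * nrm (u s) * ?X"
          using nonneg(1) by (rule mult_right_mono)
        then show "norm (nrm (z k s) * nrm (?T (n k) l x)) \<le> norm (nrm (h k s) * ?X) * nrm (u s)"
          using nonneg by (simp add: T_nrm[OF l xA] abs_mult mult_ac)
      qed
    qed
    have mixed: "(\<lambda>k. nrm (?T (n k) l (z k s))) \<longlonglongrightarrow> 0" if s: "s \<in> ?L" and l: "l \<in> ?L" and "s \<noteq> l" for s l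
    proof (rule tendsto_0_le[where K = "nrm (u s)"])
      let ?M = "\<lambda>k. inv (\<Phi> (n k) l) (b (n k) l) * inv (\<Phi> (n k) s) (h k s)"
      show "(\<lambda>k. nrm (?M k)) \<longlonglongrightarrow> 0"
        unfolding h_def by (rule lim2[OF s l \<open>s \<noteq> l\<close> g[OF s]])
      show "\<forall>\<^sub>F k in sequentially. norm (nrm (?T (n k) l (z k s))) \<le> norm (nrm (?M k)) * nrm (u s)"
      proof (rule always_eventually, rule allI)
        fix k
        have M: "?M k \<in> A"
          by (intro left inv_in h s)
        have "nrm (?T (n k) l (z k s)) = nrm (?M k * inv (\<Phi> (n k) s) (u s))"
          unfolding T_nrm[OF l z[OF s]]
          by (simp add: z_def inv_isometric_algebra_iso(3)[OF \<Phi>_iso[OF s]] mult.assoc)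
        also have "\<dots> \<le> nrm (?M k) * nrm (inv (\<Phi> (n k) s) (u s))"
          by (intro submult M inv_in u s)
        also have "nrm (inv (\<Phi> (n k) s) (u s)) = nrm (u s)"
          by (rule inv_nrm[OF s u[OF s]])
        finally have "nrm (?T (n k) l (z k s)) \<le> nrm (?M k) * nrm (u s)" .
        moreover have "0 \<le> nrm (?T (n k) l (z k s))"
          unfolding T_nrm[OF l z[OF s]] by (intro norm_onD(2)[OF nrm] left z s)
        moreover have "0 \<le> nrm (?M k)"
          by (rule norm_onD(2)[OF nrm M])
        ultimately show "norm (nrm (?T (n k) l (z k s))) \<le> norm (nrm (?M k)) * nrm (u s)"
          by simp
      qed
    qed
    show ?thesis
      by (rule semi_transitive_from_exact_preimages[where x = x and w = "\<lambda>l. g l * u l" and z = z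
            and n = n and T = ?T, OF nrm T n_mono U(1) x(2) V(1) _ z exact product mixed])
        (simp_all add: u_def w)
  qed
  show ?thesis
    unfolding dF_semi_transitive_def
  proof (intro conjI allI ballI impI)
    fix U V
    assume UV: "openin (norm_topology A nrm) U \<and> U \<noteq> {} \<and>
      (\<forall>l\<in>?L. openin (norm_topology A nrm) (V l) \<and> V l \<noteq> {})"
    have "\<exists>F. infinite F \<and> (\<forall>t\<in>F. \<exists>c>0. U \<inter> (\<Inter>l\<in>?L. (*\<^sub>R) c ` {x \<in> A. ?T t l x \<in> V l}) \<noteq> {})"
      by (rule semi) (use UV in blast)+
    then show "\<exists>F\<in>{F. infinite F}. \<forall>t\<in>F. \<exists>c>0.
        U \<inter> (\<Inter>l\<in>?L. (*\<^sub>R) c ` {x \<in> A. ?T t l x \<in> V l}) \<noteq> {}"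
      by (simp only: Bex_def mem_Collect_eq)
  qed (rule T)
qed

end
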